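(* Let $\mathsf G=(\mathsf V,m,b,c)$ be a finite graph with $m\equiv1$, standard edge weights $b\in\{0,1\}$, $c\equiv0$ and minimal cut weight $\eta_{\mathsf G}$. Let $\emptyset\neq\mathsf V_0\subset\mathsf V$ be such that $\mathsf V\setminus\mathsf V_0$ consists of $n\ge1$ vertices. Then $$\lambda_{0,2}(\mathsf G;\mathsf V_0)\ \ge\ 2\,\eta_{\mathsf G}\left(1-\cos\Big(\frac{\pi}{2n+1}\Big)\right).$$
   Context: A finite graph $\mathsf G=(\mathsf V,m,b,c)$ consists of a finite set $\mathsf V$, $m:\mathsf V\to(0,\infty)$, a symmetric $b:\mathsf V\times\mathsf V\to[0,\infty)$ with $b(\mathsf v,\mathsf v)=0$, and $c:\mathsf V\to[0,\infty)$. Minimal cut weight: $\eta_{\mathsf G}=\min\sum_{\mathsf v\in\mathsf V_1,\mathsf w\in\mathsf V_2}b(\mathsf v,\mathsf w)$, minimum over all partitions $\mathsf V=\mathsf V_1\sqcup\mathsf V_2$ into two nonempty sets. Smallest eigenvalue of the Laplacian with Dirichlet conditions at $\mathsf V_0$ (for $c\equiv0$): $$\lambda_{0,2}(\mathsf G;\mathsf V_0)=\inf_{0\ne f:\mathsf V\to\mathbb R,\ f|_{\mathsf V_0}=0}\frac{\frac12\sum_{\mathsf v,\mathsf w}b(\mathsf v,\mathsf w)|f(\mathsf v)-f(\mathsf w)|^2}{\sum_{\mathsf v\in\mathsf V\setminus\mathsf V_0}|f(\mathsf v)|^2m(\mathsf v)}.$$ *)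

theory Defs
  imports "HOL-Analysis.Analysis"
begin

locale finite_graph =
  fixes V :: "'a set"
    and m :: "'a \<Rightarrow> real"
    and b :: "'a \<Rightarrow> 'a \<Rightarrow> real"
    and c :: "'a \<Rightarrow> real"
  assumes finite_V: "finite V"
    and m_pos: "\<And>v. v \<in> V \<Longrightarrow> 0 < m v"
    and b_nonneg: "\<And>v w. v \<in> V \<Longrightarrow> w \<in> V \<Longrightarrow> 0 \<le> b v w"
    and b_sym: "\<And>v w. v \<in> V \<Longrightarrow> w \<in> V \<Longrightarrow> b v w = b w v"
    and b_diag: "\<And>v. v \<in> V \<Longrightarrow> b v v = 0"
    and c_nonneg: "\<And>v. v \<in> V \<Longrightarrow> 0 \<le> c v"

definition min_cut_weight :: "'a set \<Rightarrow> ('a \<Rightarrow> 'a \<Rightarrow> real) \<Rightarrow> real" where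
  "min_cut_weight V b =
     Min {(\<Sum>v\<in>V1. \<Sum>w\<in>V2. b v w) | V1 V2.
            V1 \<union> V2 = V \<and> V1 \<inter> V2 = {} \<and> V1 \<noteq> {} \<and> V2 \<noteq> {}}"

(* Functions on V are represented by total functions of which only the values on V matter,
   so "f is nonzero" means nonzero somewhere on V.  The potential c does not enter: the
   formula is that of the case in which c vanishes on V. *)
definition dirichlet_eigenvalue ::
    "'a set \<Rightarrow> ('a \<Rightarrow> real) \<Rightarrow> ('a \<Rightarrow> 'a \<Rightarrow> real) \<Rightarrow> 'a set \<Rightarrow> real" where
  "dirichlet_eigenvalue V m b V0 =
     Inf {(1 / 2 * (\<Sum>v\<in>V. \<Sum>w\<in>V. b v w * \<bar>f v - f w\<bar>\<^sup>2))
            / (\<Sum>v\<in>V - V0. \<bar>f v\<bar>\<^sup>2 * m v) | f :: 'a \<Rightarrow> real.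
          (\<exists>v\<in>V. f v \<noteq> 0) \<and> (\<forall>v\<in>V0. f v = 0)}"

end

theory Submission
  imports Defs
begin

text \<open>
  Replacing a test function by its absolute value and listing the vertices outside \<open>V0\<close> in
  increasing order of its values \<open>0 = a 0 \<le> a 1 \<le> \<dots> \<le> a n\<close>, the square of a
  difference along an edge dominates the sum of the squares of the increments it spans.  Collecting
  edges by increments, every increment is counted with the weight of a cut, so the energy is at
  least the minimal cut weight times the energy of \<open>a\<close> on a path with a Dirichlet condition
  at one end.  The path is treated by comparison with its positive ground state
  \<open>sin (k * pi / (2 * n + 1))\<close>.
\<close>

section \<open>Energy of a path with a Dirichlet end\<close>

text \<open>Summation by parts against the ground state: by the choice of the angle, the boundary term
  vanishes at \<open>k = n\<close>.\<close>

lemma path_energy_partial: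
  fixes a :: "nat \<Rightarrow> real" and t :: real
  assumes "a 0 = 0" and "\<And>i. 1 \<le> i \<Longrightarrow> i \<le> n \<Longrightarrow> 0 < sin (real i * t)"
    and "1 \<le> k" and "k \<le> n"
  shows "2 * (1 - cos t) * (\<Sum>i<k. (a (Suc i))\<^sup>2)
          + (a k)\<^sup>2 * (sin (real (Suc k) * t) / sin (real k * t) - 1)
         \<le> (\<Sum>i<k. (a (Suc i) - a i)\<^sup>2)"
  using assms(3,4)
proof (induction k rule: dec_induct)
  case base
  \<comment> \<open>For \<open>k = 1\<close> the ratio is \<open>2 * cos t\<close> and both sides
    equal \<open>(a 1)\<^sup>2\<close>.\<close>
  have "sin (2 * t) = 2 * sin t * cos t" by (rule sin_double)
  moreover have "sin t > 0" using assms(2)[of 1] base by simp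
  ultimately show ?case using assms(1) by (simp add: field_simps)
next
  case (step k)
  define r where "r = sin (real (Suc k) * t) / sin (real k * t)"
  have pos: "0 < sin (real k * t)" "0 < sin (real (Suc k) * t)"
    using assms(2)[of k] assms(2)[of "Suc k"] step by auto
  have r: "r > 0" using pos by (simp add: r_def)
  \<comment> \<open>The sine sequence solves the eigenvalue equation of the path for
    \<open>2 * (1 - cos t)\<close>.\<close>
  have rec: "sin (real (Suc (Suc k)) * t) = 2 * cos t * sin (real (Suc k) * t) - sin (real k * t)"
  proof -
    have "real (Suc (Suc k)) * t = real (Suc k) * t + t" "real k * t = real (Suc k) * t - t"
      by (simp_all add: algebra_simps)
    then show ?thesis by (simp only: sin_add sin_diff) simp
  qed
  have next_ratio: "sin (real (Suc (Suc k)) * t) / sin (real (Suc k) * t) = 2 * cos t - 1 / r"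
    using pos unfolding rec r_def by (simp add: diff_divide_distrib)
  \<comment> \<open>This square vanishes when \<open>a\<close> follows the ground state from
    \<open>k\<close> to \<open>Suc k\<close>. With weight \<open>r\<close>, the resulting
    \<open>(a k)\<^sup>2\<close> term cancels the boundary term of the induction hypothesis.\<close>
  have "0 \<le> (a (Suc k) - r * a k)\<^sup>2 / r" using r by simp
  also have "\<dots> = (a (Suc k))\<^sup>2 / r - 2 * a (Suc k) * a k + r * (a k)\<^sup>2"
    using r by (simp add: field_simps power2_eq_square)
  finally have "2 * a (Suc k) * a k \<le> (a (Suc k))\<^sup>2 / r + r * (a k)\<^sup>2" by simp
  then have "(a (Suc k))\<^sup>2 * (1 - 1 / r) + (a k)\<^sup>2 * (1 - r) \<le> (a (Suc k) - a k)\<^sup>2"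
    by (simp add: algebra_simps power2_diff)
  moreover have "2 * (1 - cos t) * (\<Sum>i<k. (a (Suc i))\<^sup>2) + (a k)\<^sup>2 * (r - 1)
      \<le> (\<Sum>i<k. (a (Suc i) - a i)\<^sup>2)"
    using step.IH step.prems by (simp add: r_def)
  ultimately show ?case
    unfolding next_ratio by (simp add: algebra_simps)
qed

lemma path_energy_ge:
  fixes a :: "nat \<Rightarrow> real"
  assumes "a 0 = 0" and "n \<ge> 1"
  shows "2 * (1 - cos (pi / (2 * real n + 1))) * (\<Sum>i<n. (a (Suc i))\<^sup>2)
         \<le> (\<Sum>i<n. (a (Suc i) - a i)\<^sup>2)"
proof -
  define t where "t = pi / (2 * real n + 1)"
  have t: "t > 0" "(2 * real n + 1) * t = pi"
    unfolding t_def by (auto simp: field_simps)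
  have pos: "0 < sin (real i * t)" if "1 \<le> i" "i \<le> n" for i
  proof (rule sin_gt_zero)
    show "0 < real i * t" using that t by simp
    have "real i * t < (2 * real n + 1) * t" using that t by (intro mult_strict_right_mono) auto
    then show "real i * t < pi" using t by simp
  qed
  \<comment> \<open>Reflection at \<open>pi / 2\<close>: the ground state takes equal values at
    \<open>n\<close> and \<open>Suc n\<close>, a Neumann condition at the free end.\<close>
  have "real (Suc n) * t = pi - real n * t" using t by (simp add: algebra_simps)
  then have "sin (real (Suc n) * t) = sin (real n * t)" by (metis sin_pi_minus)
  then have "sin (real (Suc n) * t) / sin (real n * t) = 1"
    using pos[of n] assms by simp
  then show ?thesis
    using path_energy_partial[of a n t n, OF assms(1) pos assms(2)] by (simp add: t_def)
qed

section \<open>Edges, levels and cuts\<close>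

text \<open>Nonnegative increments have nonnegative cross terms. The first conjunct supplies the
  sign of the cross term in the induction.\<close>

lemma sum_increment_squares_le:
  fixes g :: "nat \<Rightarrow> real"
  assumes "\<And>k. k < n \<Longrightarrow> g k \<le> g (Suc k)" and "i \<le> j" and "j \<le> n"
  shows "g i \<le> g j \<and> (\<Sum>k=i..<j. (g (Suc k) - g k)\<^sup>2) \<le> (g j - g i)\<^sup>2"
  using assms(2,3)
proof (induction j rule: dec_induct)
  case (step j)
  then have IH: "g i \<le> g j" "(\<Sum>k=i..<j. (g (Suc k) - g k)\<^sup>2) \<le> (g j - g i)\<^sup>2"
    and up: "g j \<le> g (Suc j)"
    using assms(1)[of j] by auto
  have "0 \<le> (g j - g i) * (g (Suc j) - g j)" using IH up by simp
  then have "(g j - g i)\<^sup>2 + (g (Suc j) - g j)\<^sup>2 \<le> (g (Suc j) - g i)\<^sup>2"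
    by (simp add: power2_eq_square algebra_simps)
  then show ?case using IH up step by simp
qed simp

text \<open>A discrete co-area argument: each edge pays for the levels between the ranks of its
  ends, and the edges crossing level \<open>k\<close> form the cut between ranks
  \<open>\<le> k\<close> and \<open>> k\<close>.\<close>

lemma cut_energy_le:
  fixes g :: "nat \<Rightarrow> real" and b :: "'a \<Rightarrow> 'a \<Rightarrow> real" and r :: "'a \<Rightarrow> nat"
  assumes "finite V"
    and b_nonneg: "\<And>v w. v \<in> V \<Longrightarrow> w \<in> V \<Longrightarrow> 0 \<le> b v w"
    and b_sym: "\<And>v w. v \<in> V \<Longrightarrow> w \<in> V \<Longrightarrow> b v w = b w v"
    and r_le: "\<And>v. v \<in> V \<Longrightarrow> r v \<le> n"
    and g_mono: "\<And>k. k < n \<Longrightarrow> g k \<le> g (Suc k)"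
  shows "(\<Sum>k<n. (g (Suc k) - g k)\<^sup>2 * (\<Sum>v\<in>{v\<in>V. r v \<le> k}. \<Sum>w\<in>{w\<in>V. k < r w}. b v w))
         \<le> 1 / 2 * (\<Sum>v\<in>V. \<Sum>w\<in>V. b v w * (g (r v) - g (r w))\<^sup>2)"
proof -
  define d where "d k = (g (Suc k) - g k)\<^sup>2" for k
  define I where "I v w k = (if r v \<le> k \<and> k < r w then 1 else 0 :: real)" for v w k
  define C where "C k = (\<Sum>v\<in>V. \<Sum>w\<in>V. b v w * I v w k)" for k
  have C: "C k = (\<Sum>v\<in>{v\<in>V. r v \<le> k}. \<Sum>w\<in>{w\<in>V. k < r w}. b v w)" for k
    unfolding C_def I_def using assms(1)
    by (simp add: sum.inter_filter if_distrib cong: if_cong)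
      (auto intro!: sum.cong)
  \<comment> \<open>By symmetry of \<open>b\<close> the same cut can be counted over reversed pairs,
    which later absorbs the factor \<open>1 / 2\<close>.\<close>
  have C': "C k = (\<Sum>v\<in>V. \<Sum>w\<in>V. b v w * I w v k)" for k
    unfolding C_def by (subst sum.swap) (auto intro!: sum.cong simp: b_sym)
  have pair: "(\<Sum>k<n. d k * (I v w k + I w v k)) \<le> (g (r v) - g (r w))\<^sup>2"
    if "v \<in> V" "w \<in> V" for v w
  proof -
    have *: "(\<Sum>k<n. d k * (I v w k + I w v k)) \<le> (g (r w) - g (r v))\<^sup>2"
      if "r v \<le> r w" "w \<in> V" for v w
    proof -
      \<comment> \<open>Since \<open>r v \<le> r w\<close>, the reversed indicator is zero and the
        crossed levels form one interval.\<close>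
      have "(\<Sum>k<n. d k * (I v w k + I w v k)) = (\<Sum>k<n. if r v \<le> k \<and> k < r w then d k else 0)"
        using that by (intro sum.cong) (auto simp: I_def)
      also have "\<dots> = sum d {k \<in> {..<n}. r v \<le> k \<and> k < r w}"
        by (rule sum.inter_filter[symmetric]) simp
      also have "{k \<in> {..<n}. r v \<le> k \<and> k < r w} = {r v..<r w}"
        using r_le[OF that(2)] by auto
      finally show ?thesis
        using sum_increment_squares_le[of n g, OF g_mono that(1) r_le[OF that(2)]]
        by (simp add: d_def)
    qed
    show ?thesis
      using *[of v w] *[of w v] that
      by (cases "r v \<le> r w") (auto simp: power2_commute add.commute)
  qed
  have "2 * (\<Sum>k<n. d k * C k)
        = (\<Sum>k<n. d k * (\<Sum>v\<in>V. \<Sum>w\<in>V. b v w * (I v w k + I w v k)))"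
    unfolding sum_distrib_left
  proof (intro sum.cong refl)
    fix k
    have "2 * C k = (\<Sum>v\<in>V. \<Sum>w\<in>V. b v w * I v w k) + (\<Sum>v\<in>V. \<Sum>w\<in>V. b v w * I w v k)"
      using C_def[of k] C'[of k] by simp
    also have "\<dots> = (\<Sum>v\<in>V. \<Sum>w\<in>V. b v w * (I v w k + I w v k))"
      by (simp add: sum.distrib distrib_left)
    finally show "2 * (d k * C k) = (\<Sum>v\<in>V. \<Sum>w\<in>V. d k * (b v w * (I v w k + I w v k)))"
      by (simp flip: sum_distrib_left)
  qed
  also have "\<dots> = (\<Sum>v\<in>V. \<Sum>w\<in>V. \<Sum>k<n. d k * (b v w * (I v w k + I w v k)))"
    unfolding sum_distrib_left
    by (subst sum.swap, rule sum.cong[OF refl], rule sum.swap)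
  also have "\<dots> = (\<Sum>v\<in>V. \<Sum>w\<in>V. b v w * (\<Sum>k<n. d k * (I v w k + I w v k)))"
    by (simp add: sum_distrib_left mult.left_commute)
  also have "\<dots> \<le> (\<Sum>v\<in>V. \<Sum>w\<in>V. b v w * (g (r v) - g (r w))\<^sup>2)"
    using pair b_nonneg by (intro sum_mono mult_left_mono) auto
  finally show ?thesis by (simp add: d_def C)
qed

section \<open>The minimal cut weight\<close>

lemma finite_cut_weights:
  assumes "finite V"
  shows "finite {(\<Sum>v\<in>V1. \<Sum>w\<in>V2. b v w) | V1 V2.
            V1 \<union> V2 = V \<and> V1 \<inter> V2 = {} \<and> V1 \<noteq> {} \<and> V2 \<noteq> {}}" (is "finite ?S")
proof (rule finite_subset)
  show "?S \<subseteq> (\<lambda>(V1, V2). \<Sum>v\<in>V1. \<Sum>w\<in>V2. b v w) ` (Pow V \<times> Pow V)" by force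
qed (use assms in simp)

lemma min_cut_weight_le:
  assumes "finite V" "V1 \<union> V2 = V" "V1 \<inter> V2 = {}" "V1 \<noteq> {}" "V2 \<noteq> {}"
  shows "min_cut_weight V b \<le> (\<Sum>v\<in>V1. \<Sum>w\<in>V2. b v w)"
  unfolding min_cut_weight_def
  using assms by (intro Min_le finite_cut_weights) auto

text \<open>Two distinct vertices ensure that a cut exists, so that \<open>Min\<close> is taken over
  a nonempty set.\<close>

lemma min_cut_weight_nonneg:
  assumes "finite V" "\<And>v w. v \<in> V \<Longrightarrow> w \<in> V \<Longrightarrow> 0 \<le> b v w"
    and "x \<in> V" "y \<in> V" "x \<noteq> y"
  shows "0 \<le> min_cut_weight V b"
proof -
  let ?S = "{(\<Sum>v\<in>V1. \<Sum>w\<in>V2. b v w) | V1 V2.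
            V1 \<union> V2 = V \<and> V1 \<inter> V2 = {} \<and> V1 \<noteq> {} \<and> V2 \<noteq> {}}"
  have "(\<Sum>v\<in>{x}. \<Sum>w\<in>V - {x}. b v w) \<in> ?S"
    using assms(3-5) by (intro CollectI exI[of _ "{x}"] exI[of _ "V - {x}"]) auto
  moreover have "0 \<le> s" if "s \<in> ?S" for s
    using that assms(2) by (auto intro!: sum_nonneg)
  ultimately show ?thesis
    unfolding min_cut_weight_def using finite_cut_weights[OF assms(1), of b]
    by (subst Min_ge_iff) auto
qed

section \<open>Comparison of the graph with the path\<close>

lemma ex_sorted_enumeration:
  fixes h :: "'a \<Rightarrow> real"
  assumes "finite U"
  obtains ys where "set ys = U" "distinct ys" "length ys = card U"
    "\<And>i j. i \<le> j \<Longrightarrow> j < length ys \<Longrightarrow> h (ys ! i) \<le> h (ys ! j)"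
proof -
  obtain xs where xs: "set xs = U" "distinct xs"
    using finite_distinct_list[OF assms] by auto
  define ys where "ys = sort_key h xs"
  have ys: "set ys = U" "distinct ys" using xs by (auto simp: ys_def)
  moreover have "h (ys ! i) \<le> h (ys ! j)" if "i \<le> j" "j < length ys" for i j
    using sorted_nth_mono[of "map h ys" i j] that by (simp add: ys_def)
  ultimately show thesis using that distinct_card by metis
qed

lemma energy_ge_min_cut_weight:
  fixes h :: "'a \<Rightarrow> real" and b :: "'a \<Rightarrow> 'a \<Rightarrow> real"
  assumes "finite V"
    and b_nonneg: "\<And>v w. v \<in> V \<Longrightarrow> w \<in> V \<Longrightarrow> 0 \<le> b v w"
    and b_sym: "\<And>v w. v \<in> V \<Longrightarrow> w \<in> V \<Longrightarrow> b v w = b w v"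
    and V0: "V0 \<noteq> {}" "V0 \<subseteq> V"
    and n: "card (V - V0) = n" "n \<ge> 1"
    and h_nonneg: "\<And>v. v \<in> V \<Longrightarrow> 0 \<le> h v" and h_zero: "\<And>v. v \<in> V0 \<Longrightarrow> h v = 0"
  shows "2 * min_cut_weight V b * (1 - cos (pi / (2 * real n + 1))) * (\<Sum>v\<in>V - V0. (h v)\<^sup>2)
         \<le> 1 / 2 * (\<Sum>v\<in>V. \<Sum>w\<in>V. b v w * (h v - h w)\<^sup>2)"
proof -
  obtain ys where ys: "set ys = V - V0" "distinct ys" "length ys = n"
    and ys_mono: "\<And>i j. i \<le> j \<Longrightarrow> j < n \<Longrightarrow> h (ys ! i) \<le> h (ys ! j)"
    using ex_sorted_enumeration[of "V - V0" h] assms(1) n by (metis finite_Diff)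
  \<comment> \<open>\<open>g 0\<close> is the common value on \<open>V0\<close>; the values outside
    \<open>V0\<close> follow in increasing order, shifted by one.\<close>
  define g where "g k = (case k of 0 \<Rightarrow> 0 | Suc i \<Rightarrow> h (ys ! i))" for k
  have bij: "bij_betw ((!) ys) {..<n} (V - V0)"
    using bij_betw_nth[OF ys(2)] ys by simp
  \<comment> \<open>All of \<open>V0\<close> collapses to rank \<open>0\<close>, the Dirichlet end
    of the path, so that \<open>h\<close> factors as \<open>g\<close> after
    \<open>r\<close>.\<close>
  define r where "r v = (if v \<in> V0 then 0 else Suc (inv_into {..<n} ((!) ys) v))" for v
  have r: "r v \<le> n" "h v = g (r v)" if "v \<in> V" for v
  proof -
    have "inv_into {..<n} ((!) ys) v < n" "ys ! inv_into {..<n} ((!) ys) v = v" if "v \<notin> V0"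
      using bij_betw_inv_into_right[OF bij, of v] bij_betwE[OF bij_betw_inv_into[OF bij]] that \<open>v \<in> V\<close>
      by auto
    then show "r v \<le> n" "h v = g (r v)"
      using h_zero by (auto simp: r_def g_def)
  qed
  have r_nth: "r (ys ! k) = Suc k" if "k < n" for k
    using bij_betw_inv_into_left[OF bij, of k] bij_betwE[OF bij] that by (auto simp: r_def)
  have g_mono: "g k \<le> g (Suc k)" if "k < n" for k
  proof (cases k)
    case 0
    \<comment> \<open>The first increment starts at \<open>0\<close>, so its sign comes from
      \<open>h \<ge> 0\<close>.\<close>
    have "ys ! 0 \<in> V - V0" using that 0 ys nth_mem[of 0 ys] by auto
    then show ?thesis using 0 h_nonneg by (simp add: g_def)
  next
    case (Suc i)
    then show ?thesis using ys_mono[of i k] that by (simp add: g_def)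
  qed
  have cut: "min_cut_weight V b \<le> (\<Sum>v\<in>{v\<in>V. r v \<le> k}. \<Sum>w\<in>{w\<in>V. k < r w}. b v w)"
    if "k < n" for k
  proof (rule min_cut_weight_le)
    \<comment> \<open>\<open>V0\<close> lies below every level, and \<open>ys ! k\<close>, of rank
      \<open>Suc k\<close>, lies above level \<open>k\<close>.\<close>
    show "{v\<in>V. r v \<le> k} \<noteq> {}" using V0 by (auto simp: r_def)
    have "ys ! k \<in> V - V0" using bij_betwE[OF bij] that by auto
    then show "{w\<in>V. k < r w} \<noteq> {}" using r_nth[OF that] by force
  qed (use assms(1) in auto)
  obtain x y where "x \<in> V0" "y \<in> V - V0"
    using V0 n by (metis card.empty ex_in_conv not_one_le_zero)
  \<comment> \<open>This sign permits multiplying the path inequality by the cut weight.\<close>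
  then have \<eta>: "0 \<le> min_cut_weight V b"
    using V0 by (intro min_cut_weight_nonneg[where x = x and y = y] assms(1) b_nonneg) auto
  have "(\<Sum>v\<in>V - V0. (h v)\<^sup>2) = (\<Sum>i<n. (g (Suc i))\<^sup>2)"
    using sum.reindex_bij_betw[OF bij, of "\<lambda>v. (h v)\<^sup>2"] by (simp add: g_def)
  then have "2 * min_cut_weight V b * (1 - cos (pi / (2 * real n + 1))) * (\<Sum>v\<in>V - V0. (h v)\<^sup>2)
      = min_cut_weight V b * (2 * (1 - cos (pi / (2 * real n + 1))) * (\<Sum>i<n. (g (Suc i))\<^sup>2))"
    by simp
  also have "\<dots> \<le> min_cut_weight V b * (\<Sum>i<n. (g (Suc i) - g i)\<^sup>2)"
    using path_energy_ge[of g n] n \<eta> by (intro mult_left_mono) (auto simp: g_def)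
  also have "\<dots> = (\<Sum>k<n. (g (Suc k) - g k)\<^sup>2 * min_cut_weight V b)"
    by (simp add: sum_distrib_left mult.commute)
  also have "\<dots> \<le> (\<Sum>k<n. (g (Suc k) - g k)\<^sup>2
      * (\<Sum>v\<in>{v\<in>V. r v \<le> k}. \<Sum>w\<in>{w\<in>V. k < r w}. b v w))"
    using cut by (intro sum_mono mult_left_mono) auto
  also have "\<dots> \<le> 1 / 2 * (\<Sum>v\<in>V. \<Sum>w\<in>V. b v w * (g (r v) - g (r w))\<^sup>2)"
    using assms(1) b_nonneg b_sym r(1) g_mono by (rule cut_energy_le)
  also have "\<dots> = 1 / 2 * (\<Sum>v\<in>V. \<Sum>w\<in>V. b v w * (h v - h w)\<^sup>2)"
    by (simp add: r(2))
  finally show ?thesis .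
qed

theorem corollary5p12:
  fixes V V0 :: "'a set"
    and m c :: "'a \<Rightarrow> real"
    and b :: "'a \<Rightarrow> 'a \<Rightarrow> real"
    and n :: nat
  assumes "finite_graph V m b c"
    and "\<And>v. v \<in> V \<Longrightarrow> m v = 1"
    and "\<And>v w. v \<in> V \<Longrightarrow> w \<in> V \<Longrightarrow> b v w \<in> {0, 1}"
    and "\<And>v. v \<in> V \<Longrightarrow> c v = 0"
    and "V0 \<noteq> {}" and "V0 \<subseteq> V"
    and "card (V - V0) = n" and "n \<ge> 1"
  shows "dirichlet_eigenvalue V m b V0
           \<ge> 2 * min_cut_weight V b * (1 - cos (pi / (2 * real n + 1)))"
proof -
  interpret finite_graph V m b c by fact
  obtain u where u: "u \<in> V - V0"
    using assms(7,8) by (metis card.empty ex_in_conv not_one_le_zero)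
  show ?thesis
    unfolding dirichlet_eigenvalue_def
  proof (rule cInf_greatest, goal_cases)
    case 1
    \<comment> \<open>The indicator of a vertex outside \<open>V0\<close> is admissible, so the
      infimum is over a nonempty set.\<close>
    have "(\<exists>v\<in>V. indicator {u} v \<noteq> (0::real)) \<and> (\<forall>v\<in>V0. indicator {u} v = (0::real))"
      using u by (auto simp: indicator_def)
    then show ?case by blast
  next
    case (2 x)
    then obtain f where f: "\<exists>v\<in>V. f v \<noteq> 0" "\<forall>v\<in>V0. f v = 0"
      and x: "x = (1 / 2 * (\<Sum>v\<in>V. \<Sum>w\<in>V. b v w * \<bar>f v - f w\<bar>\<^sup>2))
            / (\<Sum>v\<in>V - V0. \<bar>f v\<bar>\<^sup>2 * m v)"
      by blast
    have mass: "(\<Sum>v\<in>V - V0. \<bar>f v\<bar>\<^sup>2 * m v) = (\<Sum>v\<in>V - V0. \<bar>f v\<bar>\<^sup>2)"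
      using assms(2) by simp
    \<comment> \<open>As \<open>f\<close> vanishes on \<open>V0\<close>, it is nonzero somewhere
      outside, which makes the denominator positive.\<close>
    obtain v where v: "v \<in> V - V0" "f v \<noteq> 0" using f by auto
    have mass_pos: "0 < (\<Sum>v\<in>V - V0. \<bar>f v\<bar>\<^sup>2)"
      using finite_V v by (intro sum_pos2[of _ v]) auto
    have "2 * min_cut_weight V b * (1 - cos (pi / (2 * real n + 1))) * (\<Sum>v\<in>V - V0. \<bar>f v\<bar>\<^sup>2)
        \<le> 1 / 2 * (\<Sum>v\<in>V. \<Sum>w\<in>V. b v w * (\<bar>f v\<bar> - \<bar>f w\<bar>)\<^sup>2)"
      using energy_ge_min_cut_weight[OF finite_V b_nonneg b_sym assms(5-8), where h = "\<lambda>v. \<bar>f v\<bar>"] f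
      by simp
    \<comment> \<open>Reverse triangle inequality: passing to absolute values does not raise the
      energy.\<close>
    also have "\<dots> \<le> 1 / 2 * (\<Sum>v\<in>V. \<Sum>w\<in>V. b v w * \<bar>f v - f w\<bar>\<^sup>2)"
    proof (intro mult_left_mono sum_mono)
      show "(\<bar>f v\<bar> - \<bar>f w\<bar>)\<^sup>2 \<le> \<bar>f v - f w\<bar>\<^sup>2" for v w
        by (rule power2_le_iff_abs_le[THEN iffD2]) auto
    qed (use b_nonneg in auto)
    finally show ?case
      unfolding x mass using mass_pos by (simp only: pos_le_divide_eq)
  qed
qed

end
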